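(* For every bipartite graph $G$ with (nonempty) vertex classes $A,B$, $n=|A|+|B|$ vertices and $e(G)$ edges, $$\frac{s_2^2(G)}{2n^2\sqrt{|A||B|}}\le \mu(G)-\frac{e(G)}{\sqrt{|A||B|}}\le\sqrt{\frac{s_2(G)}{2}}.$$
   Context: $\mu(G)$ is the largest eigenvalue of the adjacency matrix of $G$. With $|A|=a$, $|B|=b$, $m=e(G)$ and $d(u)$ the degree of $u$, $s_2(G)=\sum_{u\in A}\left|d(u)-\frac{m}{a}\right|+\sum_{u\in B}\left|d(u)-\frac{m}{b}\right|$. *)

theory Defs
  imports "HOL-Analysis.Analysis"
begin

text \<open>
  The vertex set of a graph is the whole of a finite (hence nonempty) type, so that the
  adjacency matrix is a square matrix indexed by the vertices. A graph is given by its set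
  of edges, an edge being the unordered pair of its end points.
\<close>

text \<open>
  Since the classes are disjoint, every edge has exactly two elements: the graph is simple
  (no loops, no multiple edges). Isolated vertices and an empty edge set are allowed.
\<close>

definition bipartite_graph :: "'v set set \<Rightarrow> 'v set \<Rightarrow> 'v set \<Rightarrow> bool" where
  "bipartite_graph E A B \<longleftrightarrow>
     A \<union> B = UNIV \<and> A \<inter> B = {} \<and> (\<forall>e\<in>E. \<exists>u\<in>A. \<exists>v\<in>B. e = {u, v})"

definition degree :: "'v set set \<Rightarrow> 'v \<Rightarrow> nat" where
  "degree E u = card {v. {u, v} \<in> E}"

definition adjacency_matrix :: "'v::finite set set \<Rightarrow> real ^ 'v ^ 'v" where
  "adjacency_matrix E = (\<chi> u v. if {u, v} \<in> E then 1 else 0)"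

definition eigenvalue :: "real ^ 'v ^ 'v::finite \<Rightarrow> real \<Rightarrow> bool" where
  "eigenvalue M k \<longleftrightarrow> (\<exists>x. x \<noteq> 0 \<and> M *v x = k *\<^sub>R x)"

text \<open>
  The adjacency matrix is real symmetric, so all of its complex eigenvalues are real and the
  set below is its whole spectrum; it is finite and nonempty.
\<close>

definition \<mu> :: "'v::finite set set \<Rightarrow> real" where
  "\<mu> E = Max {k. eigenvalue (adjacency_matrix E) k}"

definition s2 :: "'v set set \<Rightarrow> 'v set \<Rightarrow> 'v set \<Rightarrow> real" where
  "s2 E A B =
     (\<Sum>u\<in>A. \<bar>real (degree E u) - real (card E) / real (card A)\<bar>) +
     (\<Sum>u\<in>B. \<bar>real (degree E u) - real (card E) / real (card B)\<bar>)"

end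

theory Submission
  imports Defs
begin

text \<open>
  Write \<open>a = |A|\<close>, \<open>b = |B|\<close> and \<open>N\<close> for the biadjacency matrix.

  Lower bound: the Rayleigh quotient of the vector that is constant on \<open>A\<close> and equal to the degree
  on \<open>B\<close> shows \<open>\<mu>\<^sup>2 \<ge> (\<Sum>v\<in>B. d(v)\<^sup>2) / a\<close>. By Cauchy-Schwarz this is at least
  \<open>(m\<^sup>2 + s\<^sub>B\<^sup>2) / (ab)\<close> with \<open>s\<^sub>B\<close> the part of the deviation coming from \<open>B\<close>, and the same
  holds with \<open>A\<close> and \<open>B\<close> exchanged. Adding the two and dividing by
  \<open>\<mu> + m / \<surd>(ab) \<le> 2 \<surd>(ab)\<close> gives the bound, since \<open>4ab \<le> n\<^sup>2\<close>.

  Upper bound: scale down the rows and columns of \<open>N\<close> whose degree exceeds the average of its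
  class. The resulting matrix has row sums at most \<open>m / a\<close> and column sums at most \<open>m / b\<close>, hence
  norm at most \<open>m / \<surd>(ab)\<close>. The removed part has entries in \<open>[0,1]\<close> with total at most \<open>s\<^sub>2 / 2\<close>,
  because on each side the total surplus is half of the deviation; so its Frobenius norm is at
  most \<open>\<surd>(s\<^sub>2 / 2)\<close>.
\<close>

section \<open>Eigenvalues and Rayleigh quotients of real symmetric matrices\<close>

lemma symmetric_inner_matrix_vector:
  fixes M :: "real ^ 'n::finite ^ 'n"
  assumes "transpose M = M"
  shows "x \<bullet> (M *v y) = (M *v x) \<bullet> y"
proof -
  have "(M *v x) \<bullet> y = (transpose M *v x) \<bullet> y" by (simp only: assms)
  then show ?thesis by (simp only: transpose_matrix_vector dot_lmul_matrix)
qed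

text \<open>Eigenvectors picked one per eigenvalue are nonzero and pairwise orthogonal, hence
  independent. Finiteness is what gives the \<open>Max\<close> in \<open>\<mu>\<close> its
  meaning.\<close>

lemma finite_eigenvalues_symmetric:
  fixes M :: "real ^ 'n::finite ^ 'n"
  assumes sym: "transpose M = M"
  shows "finite {k. eigenvalue M k}"
proof -
  define f where "f k = (SOME x. x \<noteq> 0 \<and> M *v x = k *\<^sub>R x)" for k
  have f: "f k \<noteq> 0 \<and> M *v f k = k *\<^sub>R f k" if "eigenvalue M k" for k
    using that unfolding eigenvalue_def f_def by (rule someI_ex)
  have orth: "orthogonal (f k) (f l)" if "eigenvalue M k" "eigenvalue M l" "k \<noteq> l" for k l
  proof -
    have "l * (f k \<bullet> f l) = k * (f k \<bullet> f l)"
      using symmetric_inner_matrix_vector[OF sym, of "f k" "f l"] f that by simp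
    with that show ?thesis by (simp add: orthogonal_def)
  qed
  have inj: "inj_on f {k. eigenvalue M k}"
    by (rule inj_onI) (metis f mem_Collect_eq orth orthogonal_self)
  have "pairwise orthogonal (f ` {k. eigenvalue M k})"
    unfolding pairwise_def using orth by fastforce
  moreover have "0 \<notin> f ` {k. eigenvalue M k}"
    using f by (metis imageE mem_Collect_eq)
  ultimately have "finite (f ` {k. eigenvalue M k})"
    using pairwise_orthogonal_independent independent_bound by blast
  with inj show ?thesis by (rule finite_imageD[rotated])
qed

text \<open>If \<open>M *v x\<close> were nonzero, a small step from \<open>x\<close> against it
  would make the form negative, since the first-order term dominates. This later turns a maximizer
  of the form into an eigenvector.\<close>

lemma positive_semidefinite_null_vector:
  fixes M :: "real ^ 'n::finite ^ 'n"
  assumes sym: "transpose M = M" and psd: "\<And>y. 0 \<le> y \<bullet> (M *v y)"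
    and null: "x \<bullet> (M *v x) = 0"
  shows "M *v x = 0"
proof (rule ccontr)
  define w where "w = M *v x"
  define q where "q = w \<bullet> (M *v w)"
  \<comment> \<open>Any positive \<open>t\<close> with \<open>t * q < 2 * (w \<bullet> w)\<close>
    would do; the \<open>+ 1\<close> guards against \<open>q = 0\<close>.\<close>
  define t where "t = (w \<bullet> w) / (q + 1)"
  assume "M *v x \<noteq> 0"
  then have p: "w \<bullet> w > 0" by (simp add: w_def)
  have q: "q \<ge> 0" unfolding q_def by (rule psd)
  have "x \<bullet> (M *v w) = w \<bullet> w"
    using symmetric_inner_matrix_vector[OF sym, of x w] by (simp add: w_def)
  then have "(x - t *\<^sub>R w) \<bullet> (M *v (x - t *\<^sub>R w)) = t * (t * q - 2 * (w \<bullet> w))"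
    using null
    by (simp add: matrix_vector_mult_diff_distrib matrix_vector_mult_scaleR inner_diff_left
        inner_diff_right q_def[symmetric] w_def[symmetric] algebra_simps)
  with psd[of "x - t *\<^sub>R w"] have "0 \<le> t * (t * q - 2 * (w \<bullet> w))" by simp
  moreover have "t > 0" using p q by (simp add: t_def)
  moreover have "t * (q + 1) = w \<bullet> w" using q by (simp add: t_def)
  ultimately have "2 * (w \<bullet> w) \<le> w \<bullet> w - t"
    by (simp add: zero_le_mult_iff algebra_simps)
  with p \<open>t > 0\<close> show False by linarith
qed

text \<open>By compactness the form attains a maximum \<open>k\<close> on the unit sphere. Then
  \<open>k *\<^sub>R mat 1 - M\<close> is positive semidefinite and its form vanishes at the
  maximizer, which therefore lies in its kernel.\<close>

lemma symmetric_eigenvalue_Rayleigh: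
  fixes M :: "real ^ 'n::finite ^ 'n"
  assumes sym: "transpose M = M"
  obtains k where "eigenvalue M k" "\<And>y. y \<bullet> (M *v y) \<le> k * (y \<bullet> y)"
proof -
  have "compact (sphere (0 :: real ^ 'n) 1)" "sphere (0 :: real ^ 'n) 1 \<noteq> {}" by auto
  moreover have "continuous_on (sphere 0 1) (\<lambda>y. y \<bullet> (M *v y))"
    by (intro continuous_intros matrix_vector_mult_linear_continuous_on)
  ultimately obtain x where x: "x \<in> sphere 0 1"
    and max: "\<And>y. y \<in> sphere 0 1 \<Longrightarrow> y \<bullet> (M *v y) \<le> x \<bullet> (M *v x)"
    using continuous_attains_sup[of "sphere 0 1" "\<lambda>y. y \<bullet> (M *v y)"] by blast
  define k where "k = x \<bullet> (M *v x)"
  have bound: "y \<bullet> (M *v y) \<le> k * (y \<bullet> y)" for y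
  proof (cases "y = 0")
    case False
    define z where "z = (1 / norm y) *\<^sub>R y"
    have "z \<in> sphere 0 1" using False by (simp add: z_def)
    then have "z \<bullet> (M *v z) \<le> k" unfolding k_def by (rule max)
    moreover have "y = norm y *\<^sub>R z" using False by (simp add: z_def)
    from arg_cong[OF this, of "\<lambda>y. y \<bullet> (M *v y)"]
    have "y \<bullet> (M *v y) = (norm y)\<^sup>2 * (z \<bullet> (M *v z))"
      by (simp add: matrix_vector_mult_scaleR power2_eq_square)
    ultimately show ?thesis
      by (simp add: power2_norm_eq_inner[symmetric] mult.commute mult_right_mono)
  qed simp
  define B where "B = k *\<^sub>R mat 1 - M"
  have B: "B *v y = k *\<^sub>R y - M *v y" for y
    unfolding B_def
    by (simp add: matrix_vector_mult_diff_rdistrib scaleR_matrix_vector_assoc[symmetric])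
  have "transpose (k *\<^sub>R mat 1 :: real ^ 'n ^ 'n) = k *\<^sub>R mat 1"
    by (simp add: transpose_def mat_def vec_eq_iff)
  with sym have "transpose B = B" by (simp add: B_def transpose_def vec_eq_iff)
  moreover have "0 \<le> y \<bullet> (B *v y)" for y
    using bound[of y] by (simp add: B inner_diff_right)
  moreover have "x \<bullet> (B *v x) = 0"
    using x by (simp add: B inner_diff_right k_def[symmetric] power2_norm_eq_inner[symmetric])
  ultimately have "B *v x = 0" by (rule positive_semidefinite_null_vector)
  then have "eigenvalue M k" using x by (auto simp: B eigenvalue_def intro!: exI[of _ x])
  with bound that show thesis by blast
qed

section \<open>Variational description of the largest adjacency eigenvalue\<close>

lemma transpose_adjacency_matrix: "transpose (adjacency_matrix E) = adjacency_matrix E"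
  by (simp add: transpose_def adjacency_matrix_def insert_commute vec_eq_iff)

lemma eigenvalue_\<mu>: "eigenvalue (adjacency_matrix E) (\<mu> E)"
  and Rayleigh_le_\<mu>: "y \<bullet> (adjacency_matrix E *v y) \<le> \<mu> E * (y \<bullet> y)"
proof -
  let ?S = "{k. eigenvalue (adjacency_matrix E) k}"
  obtain k where k: "eigenvalue (adjacency_matrix E) k"
    and bound: "\<And>y. y \<bullet> (adjacency_matrix E *v y) \<le> k * (y \<bullet> y)"
    using symmetric_eigenvalue_Rayleigh[OF transpose_adjacency_matrix] by metis
  have fin: "finite ?S"
    by (rule finite_eigenvalues_symmetric[OF transpose_adjacency_matrix])
  from Max_in[OF fin] k show "eigenvalue (adjacency_matrix E) (\<mu> E)"
    unfolding \<mu>_def by blast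
  have "k \<le> \<mu> E" unfolding \<mu>_def using fin k by (intro Max_ge) auto
  then show "y \<bullet> (adjacency_matrix E *v y) \<le> \<mu> E * (y \<bullet> y)"
    using bound[of y] mult_right_mono[of k "\<mu> E" "y \<bullet> y"] by simp
qed

text \<open>The hypothesis is tested on an eigenvector for \<open>\<mu> E\<close>.\<close>

lemma \<mu>_le:
  assumes "\<And>y. y \<bullet> (adjacency_matrix E *v y) \<le> c * (y \<bullet> y)"
  shows "\<mu> E \<le> c"
proof -
  obtain x where x: "x \<noteq> 0" "adjacency_matrix E *v x = \<mu> E *\<^sub>R x"
    using eigenvalue_\<mu> unfolding eigenvalue_def by blast
  then have "\<mu> E * (x \<bullet> x) \<le> c * (x \<bullet> x)" using assms[of x] by simp
  with x show ?thesis by simp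
qed

section \<open>Two norm bounds for bilinear forms\<close>

text \<open>AM-GM turns the product produced by Cauchy-Schwarz into a sum; with \<open>P\<close> and
  \<open>Q\<close> the squared lengths on the two classes, that sum is
  \<open>y \<bullet> y\<close>.\<close>

lemma two_mult_le_of_square_le:
  fixes S K P Q :: real
  assumes "S\<^sup>2 \<le> K * (P * Q)" "0 \<le> K" "0 \<le> P" "0 \<le> Q"
  shows "2 * S \<le> sqrt K * (P + Q)"
proof -
  have "S \<le> sqrt (K * (P * Q))" using assms(1) by (rule real_le_rsqrt)
  also have "\<dots> = sqrt K * sqrt (P * Q)" by (simp add: real_sqrt_mult)
  also have "\<dots> \<le> sqrt K * ((P + Q) / 2)"
    using assms by (intro mult_left_mono arith_geo_mean_sqrt) auto
  finally show ?thesis by simp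
qed

text \<open>Cauchy-Schwarz over pairs: the squares of \<open>y u * z v\<close> have a sum that
  factors.\<close>

lemma bilinear_form_le_Frobenius:
  fixes w :: "'a \<Rightarrow> 'b \<Rightarrow> real"
  shows "2 * (\<Sum>u\<in>A. \<Sum>v\<in>B. w u v * y u * z v)
    \<le> sqrt (\<Sum>u\<in>A. \<Sum>v\<in>B. (w u v)\<^sup>2) * ((\<Sum>u\<in>A. (y u)\<^sup>2) + (\<Sum>v\<in>B. (z v)\<^sup>2))"
proof (rule two_mult_le_of_square_le)
  show "(\<Sum>u\<in>A. \<Sum>v\<in>B. w u v * y u * z v)\<^sup>2
    \<le> (\<Sum>u\<in>A. \<Sum>v\<in>B. (w u v)\<^sup>2) * ((\<Sum>u\<in>A. (y u)\<^sup>2) * (\<Sum>v\<in>B. (z v)\<^sup>2))"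
    using Cauchy_Schwarz_ineq_sum[of "\<lambda>(u, v). w u v" "\<lambda>(u, v). y u * z v" "A \<times> B"]
    by (simp add: sum.cartesian_product case_prod_beta sum_product power_mult_distrib mult.assoc)
qed (auto intro!: sum_nonneg)

text \<open>This is the Schur test: each weight is split into two square roots, one going with
  \<open>y\<close> and one with \<open>z\<close>, so that Cauchy-Schwarz leaves row sums in one
  factor and column sums in the other.\<close>

lemma bilinear_form_le_row_column:
  fixes w :: "'a \<Rightarrow> 'b \<Rightarrow> real"
  assumes w: "\<And>u v. 0 \<le> w u v"
    and row: "\<And>u. u \<in> A \<Longrightarrow> (\<Sum>v\<in>B. w u v) \<le> R" and col: "\<And>v. v \<in> B \<Longrightarrow> (\<Sum>u\<in>A. w u v) \<le> C"
    and RC: "0 \<le> R" "0 \<le> C"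
  shows "2 * (\<Sum>u\<in>A. \<Sum>v\<in>B. w u v * y u * z v)
    \<le> sqrt (R * C) * ((\<Sum>u\<in>A. (y u)\<^sup>2) + (\<Sum>v\<in>B. (z v)\<^sup>2))"
proof (rule two_mult_le_of_square_le)
  have "sqrt (w u v) * sqrt (w u v) = w u v" for u v using w by simp
  then have split: "sqrt (w u v) * y u * (sqrt (w u v) * z v) = w u v * y u * z v" for u v
    by (metis mult.assoc mult.left_commute)
  have "(\<Sum>u\<in>A. \<Sum>v\<in>B. w u v * y u * z v)\<^sup>2
    \<le> (\<Sum>u\<in>A. \<Sum>v\<in>B. w u v * (y u)\<^sup>2) * (\<Sum>u\<in>A. \<Sum>v\<in>B. w u v * (z v)\<^sup>2)"
    using Cauchy_Schwarz_ineq_sum[of "\<lambda>(u, v). sqrt (w u v) * y u" "\<lambda>(u, v). sqrt (w u v) * z v" "A \<times> B"] w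
    by (simp add: sum.cartesian_product case_prod_beta power_mult_distrib split)
  also have "\<dots> \<le> (R * (\<Sum>u\<in>A. (y u)\<^sup>2)) * (C * (\<Sum>v\<in>B. (z v)\<^sup>2))"
  proof (rule mult_mono)
    show "(\<Sum>u\<in>A. \<Sum>v\<in>B. w u v * (y u)\<^sup>2) \<le> R * (\<Sum>u\<in>A. (y u)\<^sup>2)"
      unfolding sum_distrib_left
      by (intro sum_mono) (simp add: row mult_right_mono flip: sum_distrib_right)
    have "(\<Sum>u\<in>A. \<Sum>v\<in>B. w u v * (z v)\<^sup>2) = (\<Sum>v\<in>B. \<Sum>u\<in>A. w u v * (z v)\<^sup>2)"
      by (rule sum.swap)
    also have "\<dots> \<le> C * (\<Sum>v\<in>B. (z v)\<^sup>2)"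
      unfolding sum_distrib_left
      by (intro sum_mono) (simp add: col mult_right_mono flip: sum_distrib_right)
    finally show "(\<Sum>u\<in>A. \<Sum>v\<in>B. w u v * (z v)\<^sup>2) \<le> C * (\<Sum>v\<in>B. (z v)\<^sup>2)" .
  qed (use w RC in \<open>auto intro!: sum_nonneg mult_nonneg_nonneg\<close>)
  finally show "(\<Sum>u\<in>A. \<Sum>v\<in>B. w u v * y u * z v)\<^sup>2
    \<le> R * C * ((\<Sum>u\<in>A. (y u)\<^sup>2) * (\<Sum>v\<in>B. (z v)\<^sup>2))"
    by (simp add: mult_ac)
qed (use RC in \<open>auto intro!: sum_nonneg\<close>)

section \<open>Degrees and the adjacency form of a bipartite graph\<close>

lemma bipartite_graph_commute:
  assumes "bipartite_graph E A B"
  shows "bipartite_graph E B A"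
  unfolding bipartite_graph_def
proof (intro conjI ballI)
  fix e assume "e \<in> E"
  with assms obtain u v where "u \<in> A" "v \<in> B" "e = {u, v}"
    unfolding bipartite_graph_def by blast
  then show "\<exists>u\<in>B. \<exists>v\<in>A. e = {u, v}"
    by (intro bexI[of _ v] bexI[of _ u]) (simp_all add: insert_commute)
qed (use assms in \<open>simp_all add: bipartite_graph_def Un_commute Int_commute\<close>)

lemma
  assumes "bipartite_graph E A B"
  shows bipartite_edge_left: "{u, v} \<in> E \<Longrightarrow> u \<in> A \<longleftrightarrow> v \<in> B"
    and bipartite_in_right: "u \<in> B \<longleftrightarrow> u \<notin> A"
proof -
  have "A \<union> B = UNIV" "A \<inter> B = {}"
    using assms by (simp_all add: bipartite_graph_def)
  then show right: "u \<in> B \<longleftrightarrow> u \<notin> A" for u by blast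
  assume "{u, v} \<in> E"
  moreover have "\<forall>e\<in>E. \<exists>x\<in>A. \<exists>y\<in>B. e = {x, y}"
    using assms by (simp add: bipartite_graph_def)
  ultimately obtain x y where "x \<in> A" "y \<in> B" "{u, v} = {x, y}"
    by (metis (lifting))
  then show "u \<in> A \<longleftrightarrow> v \<in> B"
    using right[of u] right[of v] by (auto simp: doubleton_eq_iff)
qed

lemma sum_bipartite:
  fixes f :: "'v::finite \<Rightarrow> 'c::comm_monoid_add"
  assumes "bipartite_graph E A B"
  shows "(\<Sum>u\<in>UNIV. f u) = (\<Sum>u\<in>A. f u) + (\<Sum>v\<in>B. f v)"
  using assms sum.union_disjoint[of A B f] unfolding bipartite_graph_def by simp

lemma degree_bipartite:
  fixes E :: "'v::finite set set"
  assumes "bipartite_graph E A B" "u \<in> A"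
  shows "real (degree E u) = (\<Sum>v\<in>B. of_bool ({u, v} \<in> E))"
proof -
  have "{v. {u, v} \<in> E} = B \<inter> {v. {u, v} \<in> E}"
    using bipartite_edge_left[OF assms(1)] assms(2) by blast
  then show ?thesis by (simp add: degree_def of_bool_def sum.If_cases)
qed

text \<open>Each edge has exactly one end in \<open>A\<close>, so edges correspond to adjacent pairs
  in \<open>A \<times> B\<close>; these are then counted by their first component.\<close>

lemma sum_degree_bipartite:
  fixes E :: "'v::finite set set"
  assumes G: "bipartite_graph E A B"
  shows "(\<Sum>u\<in>A. real (degree E u)) = real (card E)"
proof -
  let ?P = "{(u, v). u \<in> A \<and> v \<in> B \<and> {u, v} \<in> E}"
  have "bij_betw (\<lambda>(u, v). {u, v}) ?P E"
  proof (rule bij_betw_imageI)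
    show "inj_on (\<lambda>(u, v). {u, v}) ?P"
      using bipartite_in_right[OF G] by (auto simp: inj_on_def doubleton_eq_iff)
    have "e \<in> (\<lambda>(u, v). {u, v}) ` ?P" if "e \<in> E" for e
    proof -
      from G have "\<forall>e\<in>E. \<exists>u\<in>A. \<exists>v\<in>B. e = {u, v}" by (simp add: bipartite_graph_def)
      with that obtain u v where "u \<in> A" "v \<in> B" "e = {u, v}" by meson
      with that show ?thesis by (intro image_eqI[of _ _ "(u, v)"]) auto
    qed
    then show "(\<lambda>(u, v). {u, v}) ` ?P = E" by auto
  qed
  then have "card E = card ?P" by (rule bij_betw_same_card[symmetric])
  moreover have "u \<in> A \<and> v \<in> B \<and> {u, v} \<in> E \<longleftrightarrow> u \<in> A \<and> {u, v} \<in> E" for u v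
    using bipartite_edge_left[OF G, of u v] by metis
  then have "?P = (SIGMA u:A. {v. {u, v} \<in> E})" by auto
  ultimately show ?thesis by (simp add: degree_def)
qed

text \<open>The two diagonal blocks vanish and the two off-diagonal blocks contribute
  equally.\<close>

lemma adjacency_form_bipartite:
  fixes E :: "'v::finite set set"
  assumes G: "bipartite_graph E A B"
  shows "x \<bullet> (adjacency_matrix E *v x) = 2 * (\<Sum>u\<in>A. \<Sum>v\<in>B. of_bool ({u, v} \<in> E) * x $ u * x $ v)"
proof -
  let ?f = "\<lambda>u v. of_bool ({u, v} \<in> E) * x $ u * x $ v"
  have "x \<bullet> (adjacency_matrix E *v x) = (\<Sum>u\<in>UNIV. \<Sum>v\<in>UNIV. ?f u v)"
    by (simp add: inner_vec_def matrix_vector_mult_def adjacency_matrix_def sum_distrib_left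
        of_bool_def mult_ac)
  also have "\<dots> = (\<Sum>u\<in>A. \<Sum>v\<in>A. ?f u v) + (\<Sum>u\<in>A. \<Sum>v\<in>B. ?f u v)
      + ((\<Sum>u\<in>B. \<Sum>v\<in>A. ?f u v) + (\<Sum>u\<in>B. \<Sum>v\<in>B. ?f u v))"
    by (simp add: sum_bipartite[OF G] sum.distrib)
  also have "(\<Sum>u\<in>A. \<Sum>v\<in>A. ?f u v) = 0"
    using bipartite_edge_left[OF G] bipartite_in_right[OF G] by (intro sum.neutral ballI) auto
  also have "(\<Sum>u\<in>B. \<Sum>v\<in>B. ?f u v) = 0"
    using bipartite_edge_left[OF G] bipartite_in_right[OF G] by (intro sum.neutral ballI) auto
  also have "(\<Sum>u\<in>B. \<Sum>v\<in>A. ?f u v) = (\<Sum>u\<in>A. \<Sum>v\<in>B. ?f u v)"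
    by (subst sum.swap) (simp add: insert_commute mult_ac)
  finally show ?thesis by simp
qed

lemma inner_self_bipartite:
  fixes x :: "real ^ 'v::finite"
  assumes "bipartite_graph E A B"
  shows "x \<bullet> x = (\<Sum>u\<in>A. (x $ u)\<^sup>2) + (\<Sum>v\<in>B. (x $ v)\<^sup>2)"
  by (simp add: inner_vec_def sum_bipartite[OF assms] power2_eq_square)

section \<open>The lower bound\<close>

text \<open>Without loops, the Rayleigh quotient of a basis vector is zero.\<close>

lemma \<mu>_nonneg: "0 \<le> \<mu> E" if "bipartite_graph E A B"
proof -
  fix u
  let ?x = "axis u 1 :: real ^ 'a"
  have "?x \<bullet> (adjacency_matrix E *v ?x) = 0"
    using bipartite_edge_left[OF that, of u u] bipartite_in_right[OF that, of u]
    by (auto simp: inner_axis' matrix_vector_mult_basis column_def adjacency_matrix_def)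
  with Rayleigh_le_\<mu>[of ?x E] show ?thesis by simp
qed

text \<open>Schur test for a matrix with entries 0 and 1: rows sum to at most \<open>card B\<close>,
  columns to at most \<open>card A\<close>.\<close>

lemma \<mu>_le_sqrt_card:
  assumes G: "bipartite_graph E A B"
  shows "\<mu> E \<le> sqrt (real (card A) * real (card B))"
proof (rule \<mu>_le)
  fix y :: "real ^ 'a"
  have le: "(\<Sum>v\<in>V. of_bool (P v)) \<le> real (card V)" for V :: "'a set" and P
    using sum_bounded_above[of V "\<lambda>v. of_bool (P v)" "1::real"] by simp
  show "y \<bullet> (adjacency_matrix E *v y) \<le> sqrt (real (card A) * real (card B)) * (y \<bullet> y)"
    unfolding adjacency_form_bipartite[OF G] inner_self_bipartite[OF G] mult.commute[of "real (card A)"]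
    by (rule bilinear_form_le_row_column) (use le in auto)
qed

lemma sum_degree_square_le:
  fixes E :: "'v::finite set set"
  assumes G: "bipartite_graph E A B" and "A \<noteq> {}"
  shows "(\<Sum>v\<in>B. (real (degree E v))\<^sup>2) \<le> real (card A) * (\<mu> E)\<^sup>2"
proof (cases "(\<Sum>v\<in>B. (real (degree E v))\<^sup>2) = 0")
  case False
  define S where "S = (\<Sum>v\<in>B. (real (degree E v))\<^sup>2)"
  \<comment> \<open>This value gives both classes the same share \<open>S\<close> of
    \<open>x \<bullet> x\<close>, so the Rayleigh quotient of \<open>x\<close> is exactly
    \<open>c\<close>.\<close>
  define c where "c = sqrt (S / card A)"
  define x :: "real ^ 'v" where "x = (\<chi> u. if u \<in> A then c else real (degree E u))"
  have a: "real (card A) > 0" using assms by (simp add: card_gt_0_iff)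
  have S: "S > 0" using False by (simp add: S_def less_le sum_nonneg)
  have c: "c > 0" "c\<^sup>2 * card A = S" using S a by (auto simp: c_def)
  have xA: "x $ u = c" if "u \<in> A" for u using that by (simp add: x_def)
  have xB: "x $ v = degree E v" if "v \<in> B" for v
    using that bipartite_in_right[OF G] by (simp add: x_def)
  have "(\<Sum>u\<in>A. \<Sum>v\<in>B. of_bool ({u, v} \<in> E) * x $ u * x $ v)
      = (\<Sum>v\<in>B. \<Sum>u\<in>A. of_bool ({v, u} \<in> E) * (c * degree E v))"
    by (subst sum.swap) (intro sum.cong refl, simp add: xA xB insert_commute)
  also have "\<dots> = c * S"
    unfolding S_def sum_distrib_left
  proof (rule sum.cong)
    fix v assume "v \<in> B"
    then show "(\<Sum>u\<in>A. of_bool ({v, u} \<in> E) * (c * degree E v)) = c * (real (degree E v))\<^sup>2"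
      unfolding sum_distrib_right[symmetric]
      by (simp only: degree_bipartite[OF bipartite_graph_commute[OF G], symmetric] power2_eq_square
          mult_ac)
  qed simp
  finally have form: "x \<bullet> (adjacency_matrix E *v x) = 2 * (c * S)"
    by (simp add: adjacency_form_bipartite[OF G])
  have "x \<bullet> x = 2 * S"
    using c by (simp add: inner_self_bipartite[OF G] xA xB S_def[symmetric] mult.commute)
  with form Rayleigh_le_\<mu>[of x E] have "c * S \<le> \<mu> E * S" by simp
  with S have "c \<le> \<mu> E" by simp
  with c(1) have "c\<^sup>2 \<le> (\<mu> E)\<^sup>2" by simp
  with a have "card A * c\<^sup>2 \<le> card A * (\<mu> E)\<^sup>2" by simp
  with c(2) show ?thesis by (simp add: S_def mult.commute)
qed simp

text \<open>The variance identity expresses the squared deviations from the mean through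
  \<open>m\<close> and the sum of squares; Cauchy-Schwarz compares them with the absolute
  deviations.\<close>

lemma square_sum_deviation_le:
  fixes f :: "'a \<Rightarrow> real"
  assumes "finite S" "S \<noteq> {}" "sum f S = m"
  shows "(\<Sum>v\<in>S. \<bar>f v - m / card S\<bar>)\<^sup>2 + m\<^sup>2 \<le> card S * (\<Sum>v\<in>S. (f v)\<^sup>2)"
proof -
  have b: "real (card S) > 0" using assms by (simp add: card_gt_0_iff)
  have "(\<Sum>v\<in>S. (f v - m / card S)\<^sup>2)
      = (\<Sum>v\<in>S. (f v)\<^sup>2) - 2 * (m / card S) * sum f S + card S * (m / card S)\<^sup>2"
    by (simp add: power2_diff sum.distrib sum_subtractf mult_ac
        flip: sum_divide_distrib sum_distrib_left sum_distrib_right)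
  then have "card S * (\<Sum>v\<in>S. (f v - m / card S)\<^sup>2) = card S * (\<Sum>v\<in>S. (f v)\<^sup>2) - m\<^sup>2"
    using b assms(3) by (simp add: field_simps power2_eq_square)
  moreover have "(\<Sum>v\<in>S. \<bar>f v - m / card S\<bar>)\<^sup>2 \<le> card S * (\<Sum>v\<in>S. (f v - m / card S)\<^sup>2)"
    using sum_squared_le_sum_of_squares[of "\<lambda>v. \<bar>f v - m / card S\<bar>" S] by (simp add: mult.commute)
  ultimately show ?thesis by simp
qed

lemma square_deviation_le_\<mu>:
  fixes E :: "'v::finite set set"
  assumes G: "bipartite_graph E A B" and ne: "A \<noteq> {}" "B \<noteq> {}"
  shows "(\<Sum>v\<in>B. \<bar>real (degree E v) - real (card E) / real (card B)\<bar>)\<^sup>2 + (real (card E))\<^sup>2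
    \<le> real (card A) * real (card B) * (\<mu> E)\<^sup>2"
proof -
  have "(\<Sum>v\<in>B. \<bar>real (degree E v) - real (card E) / real (card B)\<bar>)\<^sup>2 + (real (card E))\<^sup>2
      \<le> card B * (\<Sum>v\<in>B. (real (degree E v))\<^sup>2)"
    using ne by (intro square_sum_deviation_le sum_degree_bipartite[OF bipartite_graph_commute[OF G]]) auto
  also have "\<dots> \<le> card B * (real (card A) * (\<mu> E)\<^sup>2)"
    by (intro mult_left_mono sum_degree_square_le[OF G ne(1)]) simp
  finally show ?thesis by (simp add: mult_ac)
qed

lemma \<mu>_deviation_lower_bound:
  fixes E :: "'v::finite set set"
  assumes G: "bipartite_graph E A B" and ne: "A \<noteq> {}" "B \<noteq> {}"
  shows "(s2 E A B)\<^sup>2 / (2 * (real (card A) + real (card B))\<^sup>2 * sqrt (real (card A) * real (card B)))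
    \<le> \<mu> E - real (card E) / sqrt (real (card A) * real (card B))"
proof -
  define a b m where "a = real (card A)" and "b = real (card B)" and "m = real (card E)"
  define r where "r = sqrt (a * b)"
  define sA where "sA = (\<Sum>u\<in>A. \<bar>real (degree E u) - m / a\<bar>)"
  define sB where "sB = (\<Sum>u\<in>B. \<bar>real (degree E u) - m / b\<bar>)"
  have ab: "a > 0" "b > 0" using ne by (simp_all add: a_def b_def card_gt_0_iff)
  then have r: "r > 0" "r\<^sup>2 = a * b" by (simp_all add: r_def)
  have m: "m \<ge> 0" by (simp add: m_def)
  have mu: "0 \<le> \<mu> E" "\<mu> E \<le> r"
    using \<mu>_nonneg[OF G] \<mu>_le_sqrt_card[OF G] by (simp_all add: r_def a_def b_def)
  have "sB\<^sup>2 + m\<^sup>2 \<le> (r * \<mu> E)\<^sup>2"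
    using square_deviation_le_\<mu>[OF G ne]
    by (simp add: power_mult_distrib r a_def b_def m_def sB_def)
  moreover have "sA\<^sup>2 + m\<^sup>2 \<le> (r * \<mu> E)\<^sup>2"
    using square_deviation_le_\<mu>[OF bipartite_graph_commute[OF G] ne(2,1)]
    by (simp add: power_mult_distrib r a_def b_def m_def sA_def mult_ac)
  moreover have "(sA + sB)\<^sup>2 \<le> 2 * (sA\<^sup>2 + sB\<^sup>2)"
    using zero_le_power2[of "sA - sB"] by (simp add: power2_eq_square algebra_simps)
  \<comment> \<open>One factor 2 comes from adding the bounds for the two classes, the other from
    squaring \<open>sA + sB\<close>.\<close>
  ultimately have s: "(sA + sB)\<^sup>2 \<le> 4 * ((r * \<mu> E)\<^sup>2 - m\<^sup>2)" by simp
  then have "m\<^sup>2 \<le> (r * \<mu> E)\<^sup>2" using order_trans[OF zero_le_power2 s] by simp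
  then have mr: "m \<le> r * \<mu> E" using r mu by (simp add: abs_le_square_iff[symmetric] m)
  have "r * \<mu> E \<le> r\<^sup>2" using r(1) mu(2) by (simp add: power2_eq_square)
  then have sum: "r * \<mu> E + m \<le> 2 * r\<^sup>2" using mr by linarith
  have "(sA + sB)\<^sup>2 \<le> 4 * ((r * \<mu> E - m) * (r * \<mu> E + m))"
    using s by (simp add: power2_eq_square algebra_simps)
  \<comment> \<open>The difference of squares has been factored; \<open>sum\<close> bounds the
    second factor, and \<open>mr\<close> makes the first one nonnegative.\<close>
  also have "\<dots> \<le> 4 * ((r * \<mu> E - m) * (2 * r\<^sup>2))"
    using mr sum by (intro mult_left_mono) auto
  also have "\<dots> = 2 * (4 * (a * b)) * (r * \<mu> E - m)" by (simp add: r(2))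
  also have "\<dots> \<le> 2 * (a + b)\<^sup>2 * (r * \<mu> E - m)"
    using mr zero_le_power2[of "a - b"]
    by (intro mult_right_mono) (simp_all add: power2_eq_square algebra_simps)
  also have "\<dots> = (\<mu> E - m / r) * (2 * (a + b)\<^sup>2 * r)"
    using r(1) by (simp add: field_simps)
  finally have "(sA + sB)\<^sup>2 / (2 * (a + b)\<^sup>2 * r) \<le> \<mu> E - m / r"
    using ab r(1) by (subst pos_divide_le_eq) auto
  then show ?thesis
    by (simp add: s2_def sA_def sB_def a_def b_def m_def r_def)
qed

section \<open>The upper bound\<close>

text \<open>The factor that brings a row or column of sum \<open>d\<close> down to sum at most
  \<open>t\<close>. For \<open>t \<ge> 0\<close> the case split gives an isolated vertex the factor
  1, where \<open>t / d\<close> would be 0.\<close>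

definition truncation :: "real \<Rightarrow> real \<Rightarrow> real" where
  "truncation t d = (if d \<le> t then 1 else t / d)"

text \<open>The removed amount in the last claim is the positive part of \<open>d - t\<close>,
  written with an absolute value so that its sum can be compared with \<open>s2\<close>.\<close>

lemma truncation:
  assumes "0 \<le> t"
  shows "0 \<le> truncation t d" "truncation t d \<le> 1" "0 \<le> d \<Longrightarrow> d * truncation t d \<le> t"
    "0 \<le> d \<Longrightarrow> d * (1 - truncation t d) = (\<bar>d - t\<bar> + (d - t)) / 2"
proof -
  show "0 \<le> truncation t d" "truncation t d \<le> 1"
    using assms by (auto simp: truncation_def)
  show "d * truncation t d \<le> t" if "0 \<le> d"
    using assms that by (simp add: truncation_def)
  show "d * (1 - truncation t d) = (\<bar>d - t\<bar> + (d - t)) / 2" if "0 \<le> d"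
    using assms that by (simp add: truncation_def right_diff_distrib)
qed

text \<open>Deviations from the mean sum to zero, so their positive parts make up half of the
  absolute sum.\<close>

lemma sum_truncation:
  fixes E :: "'v::finite set set"
  assumes G: "bipartite_graph E A B" and "A \<noteq> {}"
  shows "(\<Sum>u\<in>A. real (degree E u) * (1 - truncation (card E / card A) (degree E u)))
    = (\<Sum>u\<in>A. \<bar>real (degree E u) - real (card E) / real (card A)\<bar>) / 2"
proof -
  have "real (card A) > 0" using assms by (simp add: card_gt_0_iff)
  then have "(\<Sum>u\<in>A. real (degree E u) - real (card E) / real (card A)) = 0"
    using assms(2) by (simp add: sum_subtractf sum_degree_bipartite[OF G])
  then show ?thesis
    by (simp add: truncation sum.distrib flip: sum_divide_distrib)
qed

lemma \<mu>_deviation_upper_bound: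
  fixes E :: "'v::finite set set"
  assumes G: "bipartite_graph E A B" and ne: "A \<noteq> {}" "B \<noteq> {}"
  shows "\<mu> E - real (card E) / sqrt (real (card A) * real (card B)) \<le> sqrt (s2 E A B / 2)"
proof -
  define a b m where "a = real (card A)" and "b = real (card B)" and "m = real (card E)"
  define e where "e u v = (of_bool ({u, v} \<in> E) :: real)" for u v
  define \<alpha> where "\<alpha> u = truncation (m / a) (degree E u)" for u
  define \<beta> where "\<beta> v = truncation (m / b) (degree E v)" for v
  define w where "w u v = e u v * \<alpha> u * \<beta> v" for u v
  define D where "D u v = e u v - w u v" for u v
  have ab: "a > 0" "b > 0" using ne by (simp_all add: a_def b_def card_gt_0_iff)
  have m: "m \<ge> 0" "m / a \<ge> 0" "m / b \<ge> 0" using ab by (simp_all add: m_def)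
  have \<alpha>: "0 \<le> \<alpha> u" "\<alpha> u \<le> 1" "degree E u * \<alpha> u \<le> m / a" for u
    using m truncation by (simp_all add: \<alpha>_def)
  have \<beta>: "0 \<le> \<beta> u" "\<beta> u \<le> 1" "degree E u * \<beta> u \<le> m / b" for u
    using m truncation by (simp_all add: \<beta>_def)
  have e: "0 \<le> e u v" "e u v \<le> 1" for u v by (simp_all add: e_def)
  have dA: "(\<Sum>v\<in>B. e u v) = degree E u" if "u \<in> A" for u
    using degree_bipartite[OF G that] by (simp add: e_def)
  have dB: "(\<Sum>u\<in>A. e u v) = degree E v" if "v \<in> B" for v
    using degree_bipartite[OF bipartite_graph_commute[OF G] that] by (simp add: e_def insert_commute)
  \<comment> \<open>Dropping one of the two factors in \<open>[0,1]\<close> leaves a matrix scaled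
    only by rows or only by columns, whose sums are known.\<close>
  have w: "0 \<le> w u v" "w u v \<le> e u v * \<alpha> u" "w u v \<le> e u v * \<beta> v" for u v
    using e \<alpha> \<beta> unfolding w_def
    by (auto intro!: mult_left_le mult_right_mono)
  have row: "(\<Sum>v\<in>B. w u v) \<le> m / a" if "u \<in> A" for u
  proof -
    have "(\<Sum>v\<in>B. w u v) \<le> (\<Sum>v\<in>B. e u v * \<alpha> u)" by (intro sum_mono w)
    then show ?thesis using \<alpha>(3)[of u] dA[OF that] by (simp flip: sum_distrib_right)
  qed
  have col: "(\<Sum>u\<in>A. w u v) \<le> m / b" if "v \<in> B" for v
  proof -
    have "(\<Sum>u\<in>A. w u v) \<le> (\<Sum>u\<in>A. e u v * \<beta> v)" by (intro sum_mono w)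
    then show ?thesis using \<beta>(3)[of v] dB[OF that] by (simp flip: sum_distrib_right)
  qed
  \<comment> \<open>On an edge \<open>D u v\<close> is \<open>1 - \<alpha> u * \<beta> v\<close>.
    This lies in \<open>[0,1]\<close>, so it bounds its own square, and it falls short of
    \<open>(1 - \<alpha> u) + (1 - \<beta> v)\<close> by
    \<open>(1 - \<alpha> u) * (1 - \<beta> v)\<close>.\<close>
  have "(D u v)\<^sup>2 \<le> e u v * (1 - \<alpha> u) + e u v * (1 - \<beta> v)" for u v
  proof -
    have "\<alpha> u * \<beta> v \<le> 1" using \<alpha>[of u] \<beta>[of v] by (simp add: mult_le_one)
    then have "(1 - \<alpha> u * \<beta> v)\<^sup>2 \<le> 1 - \<alpha> u * \<beta> v"
      using \<alpha>(1)[of u] \<beta>(1)[of v] by (simp add: power2_eq_square mult_left_le)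
    moreover have "0 \<le> (1 - \<alpha> u) * (1 - \<beta> v)" using \<alpha>(2)[of u] \<beta>(2)[of v] by simp
    ultimately show ?thesis by (simp add: D_def w_def e_def of_bool_def algebra_simps)
  qed
  then have "(\<Sum>u\<in>A. \<Sum>v\<in>B. (D u v)\<^sup>2)
      \<le> (\<Sum>u\<in>A. \<Sum>v\<in>B. e u v * (1 - \<alpha> u) + e u v * (1 - \<beta> v))"
    by (intro sum_mono)
  also have "\<dots> = (\<Sum>u\<in>A. \<Sum>v\<in>B. e u v * (1 - \<alpha> u)) + (\<Sum>v\<in>B. \<Sum>u\<in>A. e u v * (1 - \<beta> v))"
    by (simp add: sum.distrib sum.swap[of _ B A])
  also have "\<dots> = (\<Sum>u\<in>A. degree E u * (1 - \<alpha> u)) + (\<Sum>v\<in>B. degree E v * (1 - \<beta> v))"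
    by (simp add: dA dB flip: sum_distrib_right)
  also have "\<dots> = s2 E A B / 2"
    using sum_truncation[OF G ne(1)] sum_truncation[OF bipartite_graph_commute[OF G] ne(2)]
    by (simp add: \<alpha>_def \<beta>_def a_def b_def m_def s2_def)
  finally have Frobenius: "(\<Sum>u\<in>A. \<Sum>v\<in>B. (D u v)\<^sup>2) \<le> s2 E A B / 2" .
  have avg: "sqrt (m / a * (m / b)) = m / sqrt (a * b)"
    using m by (simp add: real_sqrt_divide)
  have "\<mu> E \<le> m / sqrt (a * b) + sqrt (s2 E A B / 2)"
  proof (rule \<mu>_le)
    fix y :: "real ^ 'v"
    have "y \<bullet> (adjacency_matrix E *v y)
        = 2 * (\<Sum>u\<in>A. \<Sum>v\<in>B. w u v * y $ u * y $ v) + 2 * (\<Sum>u\<in>A. \<Sum>v\<in>B. D u v * y $ u * y $ v)"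
      unfolding adjacency_form_bipartite[OF G] D_def e_def[symmetric]
      by (simp add: left_diff_distrib sum_subtractf)
    \<comment> \<open>The truncated part is handled by the Schur test, the removed part by its
      Frobenius norm.\<close>
    also have "\<dots> \<le> sqrt (m / a * (m / b)) * (y \<bullet> y) + sqrt (\<Sum>u\<in>A. \<Sum>v\<in>B. (D u v)\<^sup>2) * (y \<bullet> y)"
      unfolding inner_self_bipartite[OF G]
      by (intro add_mono bilinear_form_le_row_column bilinear_form_le_Frobenius w row col m)
    also have "\<dots> \<le> (m / sqrt (a * b) + sqrt (s2 E A B / 2)) * (y \<bullet> y)"
      unfolding avg distrib_right using Frobenius by (intro add_left_mono mult_right_mono) auto
    finally show "y \<bullet> (adjacency_matrix E *v y)
      \<le> (m / sqrt (a * b) + sqrt (s2 E A B / 2)) * (y \<bullet> y)" .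
  qed
  then show ?thesis by (simp add: a_def b_def m_def)
qed

theorem theorem10:
  fixes E :: "'v::finite set set" and A B :: "'v set" and n :: nat
  assumes "bipartite_graph E A B"
    and "A \<noteq> {}" and "B \<noteq> {}"
    and "n = card A + card B"
  shows "(s2 E A B)\<^sup>2 / (2 * (real n)\<^sup>2 * sqrt (real (card A) * real (card B)))
           \<le> \<mu> E - real (card E) / sqrt (real (card A) * real (card B)) \<and>
         \<mu> E - real (card E) / sqrt (real (card A) * real (card B))
           \<le> sqrt (s2 E A B / 2)"
  using \<mu>_deviation_lower_bound[OF assms(1-3)] \<mu>_deviation_upper_bound[OF assms(1-3)] assms(4) by simp

end
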